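(* Let $G$ be a simple graph and let $e$ be an edge of $G$. Then $e$ is a regular edge of $G$ if and only if $e$ satisfies Property $P$.
   Context: All graphs are finite. Let $G$ be a simple graph with vertex set $V(G)=\{x_1,\dots,x_n\}$ and edge set $E(G)$, let $k$ be a field, and let $R=k[x_1,\dots,x_n]$ be the polynomial ring whose variables are identified with the vertices of $G$. The edge ideal is $I(G)=\langle uv \mid \{u,v\}\in E(G)\rangle\subseteq R$. An edge $e=\{a,b\}$ is identified with the monomial $ab$. Regular edge: an edge $e=\{a,b\}$ of $G$ is regular if for every associated prime $Q$ of $I(G)$ (i.e. of $R/I(G)$) one has $ab\notin Q^2$; that is, precisely one of $a,b$ is in $Q$. Property $P$: an edge $e=\{x,y\}\in E(G)$ has (satisfies) Property $P$ if for any $a,b\in V(G)$ with $\{a,x\},\{y,b\}\in E(G)$ we have $a\neq b$ and $\{a,b\}\in E(G)$. *)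

theory Defs
  imports "HOL-Algebra.QuotRing" "HOL-Algebra.Ideal_Product" "HOL-Library.Poly_Mapping"
begin

definition simple_graph :: "'v set \<Rightarrow> 'v set set \<Rightarrow> bool" where
  "simple_graph V E \<longleftrightarrow> finite V \<and> (\<forall>e\<in>E. e \<subseteq> V \<and> card e = 2)"

text \<open>
  The polynomial ring over the field \<open>'k\<close> whose variables are the elements of \<open>V\<close>. A monomial is a
  finitely supported exponent function of type \<open>'v \<Rightarrow>\<^sub>0 nat\<close>, and a polynomial is a finitely supported
  function from monomials to coefficients; the product on \<open>\<Rightarrow>\<^sub>0\<close> is the convolution product.
\<close>

definition mpoly_ring :: "'v set \<Rightarrow> (('v \<Rightarrow>\<^sub>0 nat) \<Rightarrow>\<^sub>0 'k::field) ring" where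
  "mpoly_ring V =
    \<lparr>carrier = {p. \<forall>m\<in>Poly_Mapping.keys p. Poly_Mapping.keys m \<subseteq> V}, mult = (*), one = 1, zero = 0, add = (+)\<rparr>"

definition mpoly_var :: "'v \<Rightarrow> (('v \<Rightarrow>\<^sub>0 nat) \<Rightarrow>\<^sub>0 'k::field)" where
  "mpoly_var v = Poly_Mapping.single (Poly_Mapping.single v 1) 1"

definition edge_monomial :: "'v set \<Rightarrow> (('v \<Rightarrow>\<^sub>0 nat) \<Rightarrow>\<^sub>0 'k::field)" where
  "edge_monomial e = (\<Prod>v\<in>e. mpoly_var v)"

definition edge_ideal :: "'v set \<Rightarrow> 'v set set \<Rightarrow> (('v \<Rightarrow>\<^sub>0 nat) \<Rightarrow>\<^sub>0 'k::field) set" where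
  "edge_ideal V E = genideal (mpoly_ring V) (edge_monomial ` E)"

text \<open>
  The associated primes of the \<open>R\<close>-module \<open>R/I\<close>: the prime ideals of \<open>R\<close> that are the annihilator
  of some element \<open>x\<close> of \<open>R/I\<close>. An element \<open>r\<close> of \<open>R\<close> acts on \<open>R/I\<close> as multiplication by its
  residue class.
\<close>

definition associated_primes :: "('a, 'b) ring_scheme \<Rightarrow> 'a set \<Rightarrow> 'a set set" where
  "associated_primes R I =
    {Q. primeideal Q R \<and>
        (\<exists>x\<in>carrier (R Quot I).
           Q = {r \<in> carrier R. (I +>\<^bsub>R\<^esub> r) \<otimes>\<^bsub>R Quot I\<^esub> x = \<zero>\<^bsub>R Quot I\<^esub>})}"

text \<open>The type argument is the coefficient field.\<close>

definition regular_edge :: "'k::field itself \<Rightarrow> 'v set \<Rightarrow> 'v set set \<Rightarrow> 'v set \<Rightarrow> bool" where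
  "regular_edge _ V E e \<longleftrightarrow>
    (\<forall>Q \<in> associated_primes (mpoly_ring V) (edge_ideal V E :: (('v \<Rightarrow>\<^sub>0 nat) \<Rightarrow>\<^sub>0 'k) set).
       edge_monomial e \<notin> ideal_prod (mpoly_ring V) Q Q)"

definition property_P :: "'v set \<Rightarrow> 'v set set \<Rightarrow> 'v set \<Rightarrow> bool" where
  "property_P V E e \<longleftrightarrow>
    (\<forall>x y. e = {x, y} \<longrightarrow>
      (\<forall>a\<in>V. \<forall>b\<in>V. {a, x} \<in> E \<and> {y, b} \<in> E \<longrightarrow> a \<noteq> b \<and> {a, b} \<in> E))"

lemma mpoly_ring_simps [simp]:
  "p \<in> carrier (mpoly_ring V) \<longleftrightarrow> (\<forall>m\<in>Poly_Mapping.keys p. Poly_Mapping.keys m \<subseteq> V)"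
  "p \<otimes>\<^bsub>mpoly_ring V\<^esub> q = p * q"
  "\<one>\<^bsub>mpoly_ring V\<^esub> = 1"
  "p \<oplus>\<^bsub>mpoly_ring V\<^esub> q = p + q"
  "\<zero>\<^bsub>mpoly_ring V\<^esub> = 0"
  by (simp_all add: mpoly_ring_def)

lemma mpoly_ring_mult_closed:
  fixes p q :: "('v \<Rightarrow>\<^sub>0 nat) \<Rightarrow>\<^sub>0 'k::field"
  assumes "\<forall>m\<in>Poly_Mapping.keys p. Poly_Mapping.keys m \<subseteq> V" "\<forall>m\<in>Poly_Mapping.keys q. Poly_Mapping.keys m \<subseteq> V"
  shows "\<forall>m\<in>Poly_Mapping.keys (p * q). Poly_Mapping.keys m \<subseteq> V"
proof
  fix m assume "m \<in> Poly_Mapping.keys (p * q)"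
  then obtain a b where "m = a + b" "a \<in> Poly_Mapping.keys p" "b \<in> Poly_Mapping.keys q"
    using keys_mult[of p q] by auto
  then show "Poly_Mapping.keys m \<subseteq> V"
    using assms Poly_Mapping.keys_add[of a b] by blast
qed

lemma cring_mpoly_ring: "cring (mpoly_ring V :: (('v \<Rightarrow>\<^sub>0 nat) \<Rightarrow>\<^sub>0 'k::field) ring)"
proof (rule cringI)
  show "abelian_group (mpoly_ring V :: (('v \<Rightarrow>\<^sub>0 nat) \<Rightarrow>\<^sub>0 'k) ring)"
  proof (rule abelian_groupI)
    fix p q :: "('v \<Rightarrow>\<^sub>0 nat) \<Rightarrow>\<^sub>0 'k"
    assume "p \<in> carrier (mpoly_ring V)" "q \<in> carrier (mpoly_ring V)"
    then show "p \<oplus>\<^bsub>mpoly_ring V\<^esub> q \<in> carrier (mpoly_ring V)"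
      using Poly_Mapping.keys_add[of p q] by fastforce
  next
    fix p :: "('v \<Rightarrow>\<^sub>0 nat) \<Rightarrow>\<^sub>0 'k"
    assume "p \<in> carrier (mpoly_ring V)"
    then show "\<exists>q\<in>carrier (mpoly_ring V). q \<oplus>\<^bsub>mpoly_ring V\<^esub> p = \<zero>\<^bsub>mpoly_ring V\<^esub>"
      by (intro bexI[of _ "- p"]) simp_all
  qed (simp_all add: algebra_simps)
  show "Group.comm_monoid (mpoly_ring V :: (('v \<Rightarrow>\<^sub>0 nat) \<Rightarrow>\<^sub>0 'k) ring)"
    by (rule comm_monoidI) (auto simp: algebra_simps dest: mpoly_ring_mult_closed[THEN bspec, rotated 2])
qed (simp add: algebra_simps)

lemma edge_monomial_doubleton:
  "x \<noteq> y \<Longrightarrow> edge_monomial {x, y} = mpoly_var x * mpoly_var y"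
  by (simp add: edge_monomial_def)

lemma edge_monomial_closed:
  assumes "simple_graph V E" "e \<in> E"
  shows "edge_monomial e \<in> carrier (mpoly_ring V :: (('v \<Rightarrow>\<^sub>0 nat) \<Rightarrow>\<^sub>0 'k::field) ring)"
proof -
  obtain x y where xy: "e = {x, y}" "x \<noteq> y" "x \<in> V" "y \<in> V"
    using assms by (auto simp: simple_graph_def card_2_iff)
  have "mpoly_var v \<in> carrier (mpoly_ring V :: (('v \<Rightarrow>\<^sub>0 nat) \<Rightarrow>\<^sub>0 'k) ring)" if "v \<in> V" for v
    using that by (simp add: mpoly_var_def)
  with xy show ?thesis
    using mpoly_ring_mult_closed[of "mpoly_var x :: ('v \<Rightarrow>\<^sub>0 nat) \<Rightarrow>\<^sub>0 'k" V "mpoly_var y"]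
    by (simp add: edge_monomial_doubleton)
qed

lemma ideal_edge_ideal:
  assumes "simple_graph V E"
  shows "ideal (edge_ideal V E) (mpoly_ring V :: (('v \<Rightarrow>\<^sub>0 nat) \<Rightarrow>\<^sub>0 'k::field) ring)"
  unfolding edge_ideal_def
proof (rule ring.genideal_ideal)
  show "ring (mpoly_ring V :: (('v \<Rightarrow>\<^sub>0 nat) \<Rightarrow>\<^sub>0 'k) ring)"
    by (rule cring.axioms(1)[OF cring_mpoly_ring])
  show "edge_monomial ` E \<subseteq> carrier (mpoly_ring V :: (('v \<Rightarrow>\<^sub>0 nat) \<Rightarrow>\<^sub>0 'k) ring)"
    using edge_monomial_closed[OF assms] by (rule image_subsetI)
qed

end

theory Submission
  imports Defs
begin

text \<open>
  The edge ideal \<open>I\<close> consists of the polynomials all of whose monomials have a support containing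
  an edge (\<open>edge_ideal_eq_squarefree_ideal\<close>), and an associated prime is a prime ideal of the form
  \<open>(I : f)\<close> (\<open>associated_primes_eq_colon\<close>). For an independent set \<open>S\<close> of vertices let \<open>P\<^sub>S\<close> be the ideal
  generated by the variables outside \<open>S\<close>. It contains \<open>I\<close>, because no edge lies in \<open>S\<close>, and it is prime.

  Suppose that Property \<open>P\<close> fails for \<open>e = {x, y}\<close>, with \<open>a\<close> adjacent to \<open>x\<close> and \<open>b\<close> adjacent to
  \<open>y\<close>. Then \<open>{a, b}\<close> is independent and lies in a maximal independent set \<open>S\<close>. Maximality makes every vertex
  outside \<open>S\<close> adjacent to \<open>S\<close>, so that \<open>P\<^sub>S\<close> is the annihilator of the product of the variables in \<open>S\<close> and hence
  an associated prime. It contains both \<open>x\<close> and \<open>y\<close>, since these are adjacent to \<open>a\<close> and \<open>b\<close>, and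
  therefore \<open>xy \<in> P\<^sub>S\<^sup>2\<close>: the edge is not regular.

  Suppose that Property \<open>P\<close> holds, and let \<open>Q = (I : f)\<close> be an associated prime. If \<open>Q\<close> contained both \<open>x\<close> and \<open>y\<close>,
  then a monomial of \<open>f\<close> outside \<open>I\<close> would involve a neighbour of \<open>x\<close> and a neighbour of \<open>y\<close>; these two are
  adjacent by Property \<open>P\<close>, which puts the monomial into \<open>I\<close>. So, say, \<open>y \<notin> Q\<close>, and some monomial of
  \<open>y f\<close> has an independent support \<open>S\<close>. From \<open>Q f \<subseteq> I \<subseteq> P\<^sub>S\<close> and \<open>f \<notin> P\<^sub>S\<close> follows
  \<open>Q \<subseteq> P\<^sub>S\<close>. As \<open>y \<in> S\<close>, every monomial of an element of \<open>Q\<close> involves a variable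
  other than \<open>y\<close>, whereas in any factorization of \<open>xy\<close> one of the two factors is \<open>1\<close> or \<open>y\<close>. Hence
  \<open>xy \<notin> Q\<^sup>2\<close>.

  Both halves need that \<open>P\<^sub>S\<close> is prime. Its core is \<open>exists_unique_sum\<close>: two finite sets of monomials always
  have a product that arises in only one way, so its coefficient in a product of polynomials cannot
  cancel.
\<close>

section \<open>Monomials and the coefficients of a product\<close>

lemma keys_add_nat:
  fixes k l :: "'v \<Rightarrow>\<^sub>0 nat"
  shows "Poly_Mapping.keys (k + l) = Poly_Mapping.keys k \<union> Poly_Mapping.keys l"
  by (auto simp: in_keys_iff lookup_add)

lemma lookup_mult_unique:
  fixes p q :: "'a::comm_monoid_add \<Rightarrow>\<^sub>0 'k::comm_semiring_0"
  assumes unique: "\<And>k l. k \<in> Poly_Mapping.keys p \<Longrightarrow> l \<in> Poly_Mapping.keys q \<Longrightarrow> k + l = a + b \<Longrightarrow> k = a \<and> l = b"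
  shows "Poly_Mapping.lookup (p * q) (a + b) = Poly_Mapping.lookup p a * Poly_Mapping.lookup q b"
proof -
  have inner: "(\<Sum>r. Poly_Mapping.lookup q r when a + b = l + r) = (Poly_Mapping.lookup q b when l = a)"
    if l: "l \<in> Poly_Mapping.keys p" for l
  proof -
    have "(Poly_Mapping.lookup q r when a + b = l + r) = ((Poly_Mapping.lookup q b when l = a) when r = b)" for r
    proof (cases "r \<in> Poly_Mapping.keys q \<and> l + r = a + b")
      case True
      with unique[OF l, of r] show ?thesis by simp
    next
      case False
      then have "a + b \<noteq> l + r \<or> Poly_Mapping.lookup q r = 0"
        by (auto simp: in_keys_iff)
      then show ?thesis by (auto simp: when_def)
    qed
    then show ?thesis by simp
  qed
  have "Poly_Mapping.lookup p l * (\<Sum>r. Poly_Mapping.lookup q r when a + b = l + r)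
      = (Poly_Mapping.lookup p a * Poly_Mapping.lookup q b when l = a)" for l
  proof (cases "l \<in> Poly_Mapping.keys p")
    case True
    then show ?thesis by (simp only: inner) (simp add: when_def)
  next
    case False
    then show ?thesis by (auto simp: when_def in_keys_iff)
  qed
  then show ?thesis by (simp add: lookup_mult)
qed

text \<open>
  The classical choice of \<open>a\<close> and \<open>b\<close> is the lexicographically largest element of each set. The induction
  below makes that choice one variable at a time, keeping the elements in which the exponent of the
  current variable is maximal, and so no order on the variables is involved.
\<close>

lemma exists_unique_sum:
  fixes A B :: "('v \<Rightarrow>\<^sub>0 nat) set"
  assumes "finite W" "finite A" "finite B" "A \<noteq> {}" "B \<noteq> {}"
    and "\<forall>m\<in>A \<union> B. Poly_Mapping.keys m \<subseteq> W"
  shows "\<exists>a\<in>A. \<exists>b\<in>B. \<forall>k\<in>A. \<forall>l\<in>B. k + l = a + b \<longrightarrow> k = a \<and> l = b"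
proof -
  \<comment> \<open>the induction hypothesis is applied to subsets whose exponents outside \<open>W\<close> are constant but need not vanish\<close>
  have "\<exists>a\<in>A. \<exists>b\<in>B. \<forall>k\<in>A. \<forall>l\<in>B. k + l = a + b \<longrightarrow> k = a \<and> l = b"
    if "finite W" "finite A" "finite B" "A \<noteq> {}" "B \<noteq> {}"
      "\<And>k l v. k \<in> A \<Longrightarrow> l \<in> A \<Longrightarrow> v \<notin> W \<Longrightarrow> Poly_Mapping.lookup k v = Poly_Mapping.lookup l v"
      "\<And>k l v. k \<in> B \<Longrightarrow> l \<in> B \<Longrightarrow> v \<notin> W \<Longrightarrow> Poly_Mapping.lookup k v = Poly_Mapping.lookup l v"
    for A B :: "('v \<Rightarrow>\<^sub>0 nat) set" and W
    using that
  proof (induction W arbitrary: A B rule: finite_induct)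
    case empty
    have eqA: "k = l" if "k \<in> A" "l \<in> A" for k l
      by (rule poly_mapping_eqI) (simp add: empty.prems(5)[OF that])
    have eqB: "k = l" if "k \<in> B" "l \<in> B" for k l
      by (rule poly_mapping_eqI) (simp add: empty.prems(6)[OF that])
    obtain a b where "a \<in> A" "b \<in> B" using empty.prems(3,4) by blast
    with eqA eqB show ?case by blast
  next
    case (insert v W)
    let ?d = "\<lambda>m. Poly_Mapping.lookup m v"
    define top where "top = (\<lambda>C :: ('v \<Rightarrow>\<^sub>0 nat) set. {m \<in> C. ?d m = Max (?d ` C)})"
    have top: "finite (top C)" "top C \<noteq> {}" if "finite C" "C \<noteq> {}" for C :: "('v \<Rightarrow>\<^sub>0 nat) set"
    proof -
      have "Max (?d ` C) \<in> ?d ` C" using that by (intro Max_in) auto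
      then show "top C \<noteq> {}" unfolding top_def by force
      show "finite (top C)" using that(1) unfolding top_def by simp
    qed
    have le: "?d m \<le> Max (?d ` C)" if "finite C" "m \<in> C" for m and C :: "('v \<Rightarrow>\<^sub>0 nat) set"
      using that by simp
    have agree: "Poly_Mapping.lookup k u = Poly_Mapping.lookup l u"
      if "k \<in> top C" "l \<in> top C" "u \<notin> W" "C = A \<or> C = B" for k l u C
    proof (cases "u = v")
      case True
      with that(1,2) show ?thesis by (simp add: top_def)
    next
      case False
      with that(3) have "u \<notin> insert v W" by simp
      with that(1,2,4) show ?thesis
        using insert.prems(5)[of k l u] insert.prems(6)[of k l u] unfolding top_def by blast
    qed
    have "\<exists>a\<in>top A. \<exists>b\<in>top B. \<forall>k\<in>top A. \<forall>l\<in>top B. k + l = a + b \<longrightarrow> k = a \<and> l = b"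
    proof (rule insert.IH)
      show "Poly_Mapping.lookup k u = Poly_Mapping.lookup l u" if "k \<in> top A" "l \<in> top A" "u \<notin> W" for k l u
        using agree[OF that] by blast
      show "Poly_Mapping.lookup k u = Poly_Mapping.lookup l u" if "k \<in> top B" "l \<in> top B" "u \<notin> W" for k l u
        using agree[OF that] by blast
    qed (fact top[OF insert.prems(1,3)] top[OF insert.prems(2,4)])+
    then obtain a b where ab: "a \<in> top A" "b \<in> top B"
      and unique: "\<forall>k\<in>top A. \<forall>l\<in>top B. k + l = a + b \<longrightarrow> k = a \<and> l = b"
      by blast
    have "k = a \<and> l = b" if kl: "k \<in> A" "l \<in> B" "k + l = a + b" for k l
    proof -
      \<comment> \<open>a sum of two numbers equals the sum of the maxima only if both are maximal\<close>
      have "?d k + ?d l = ?d a + ?d b"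
        using kl(3) by (metis lookup_add)
      moreover have "?d a = Max (?d ` A)" "?d b = Max (?d ` B)"
        using ab unfolding top_def by blast+
      ultimately have "?d k = Max (?d ` A)" "?d l = Max (?d ` B)"
        using le[OF insert.prems(1) kl(1)] le[OF insert.prems(2) kl(2)] by linarith+
      with kl(1,2) have "k \<in> top A" "l \<in> top B" unfolding top_def by blast+
      with kl(3) unique show ?thesis by blast
    qed
    moreover have "a \<in> A" "b \<in> B" using ab unfolding top_def by blast+
    ultimately show ?case by blast
  qed
  moreover have "Poly_Mapping.lookup m v = 0" if "m \<in> A \<union> B" "v \<notin> W" for m v
    using assms(6) that by (metis in_keys_iff subsetD)
  ultimately show ?thesis using assms(1-5) by simp
qed

text \<open>
  Setting the variables outside \<open>S\<close> to zero turns this into the absence of zero divisors in a polynomial ring.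
\<close>

lemma keys_mult_supported:
  fixes p q :: "('v \<Rightarrow>\<^sub>0 nat) \<Rightarrow>\<^sub>0 'k::field"
  assumes "finite S"
    and "\<exists>m\<in>Poly_Mapping.keys p. Poly_Mapping.keys m \<subseteq> S"
    and "\<exists>m\<in>Poly_Mapping.keys q. Poly_Mapping.keys m \<subseteq> S"
  shows "\<exists>m\<in>Poly_Mapping.keys (p * q). Poly_Mapping.keys m \<subseteq> S"
proof -
  define A where "A = {m \<in> Poly_Mapping.keys p. Poly_Mapping.keys m \<subseteq> S}"
  define B where "B = {m \<in> Poly_Mapping.keys q. Poly_Mapping.keys m \<subseteq> S}"
  have "\<exists>a\<in>A. \<exists>b\<in>B. \<forall>k\<in>A. \<forall>l\<in>B. k + l = a + b \<longrightarrow> k = a \<and> l = b"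
    using assms by (intro exists_unique_sum[of S]) (auto simp: A_def B_def)
  then obtain a b where ab: "a \<in> A" "b \<in> B"
    and unique: "\<And>k l. k \<in> A \<Longrightarrow> l \<in> B \<Longrightarrow> k + l = a + b \<Longrightarrow> k = a \<and> l = b"
    by blast
  have supp: "Poly_Mapping.keys (a + b) \<subseteq> S"
    using ab by (auto simp: A_def B_def keys_add_nat)
  have "Poly_Mapping.lookup (p * q) (a + b) = Poly_Mapping.lookup p a * Poly_Mapping.lookup q b"
  proof (rule lookup_mult_unique)
    fix k l assume kl: "k \<in> Poly_Mapping.keys p" "l \<in> Poly_Mapping.keys q" "k + l = a + b"
    \<comment> \<open>exponents are nonnegative, so the factors of a monomial supported in \<open>S\<close> are supported in \<open>S\<close>\<close>
    have "Poly_Mapping.keys k \<union> Poly_Mapping.keys l \<subseteq> S"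
      using supp kl(3) keys_add_nat[of k l] by simp
    with kl show "k = a \<and> l = b" by (intro unique) (auto simp: A_def B_def)
  qed
  then have "a + b \<in> Poly_Mapping.keys (p * q)"
    using ab by (simp add: A_def B_def in_keys_iff)
  with supp show ?thesis by blast
qed

definition squarefree_monomial :: "'v set \<Rightarrow> ('v \<Rightarrow>\<^sub>0 nat)" where
  "squarefree_monomial S = (\<Sum>v\<in>S. Poly_Mapping.single v 1)"

lemma lookup_squarefree_monomial:
  "finite S \<Longrightarrow> Poly_Mapping.lookup (squarefree_monomial S) v = (1 when v \<in> S)"
  by (simp add: squarefree_monomial_def lookup_sum lookup_single when_def)

lemma keys_squarefree_monomial [simp]:
  "finite S \<Longrightarrow> Poly_Mapping.keys (squarefree_monomial S) = S"
  by (auto simp: in_keys_iff lookup_squarefree_monomial when_def split: if_splits)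

lemma edge_monomial_eq_single:
  "finite S \<Longrightarrow> edge_monomial S = Poly_Mapping.single (squarefree_monomial S) 1"
  unfolding edge_monomial_def squarefree_monomial_def mpoly_var_def
  by (induction S rule: finite_induct) (simp_all add: mult_single)

text \<open>
  \<^const>\<open>edge_monomial\<close> is used for arbitrary finite sets of vertices: for a singleton it is a variable, and
  for a maximal independent set it is the polynomial whose annihilator is an associated prime.
\<close>

lemma keys_edge_monomial_mult:
  fixes f :: "('v \<Rightarrow>\<^sub>0 nat) \<Rightarrow>\<^sub>0 'k::field"
  assumes "finite S"
  shows "Poly_Mapping.keys (edge_monomial S * f) = (+) (squarefree_monomial S) ` Poly_Mapping.keys f"
proof -
  have "Poly_Mapping.lookup (edge_monomial S * f) (squarefree_monomial S + m) = Poly_Mapping.lookup f m" for m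
    unfolding edge_monomial_eq_single[OF assms] by (subst lookup_mult_unique) auto
  then have "squarefree_monomial S + m \<in> Poly_Mapping.keys (edge_monomial S * f)" if "m \<in> Poly_Mapping.keys f" for m
    using that by (simp add: in_keys_iff)
  moreover have "Poly_Mapping.keys (edge_monomial S * f) \<subseteq> (+) (squarefree_monomial S) ` Poly_Mapping.keys f"
    using keys_mult[of "edge_monomial S" f] by (auto simp: edge_monomial_eq_single[OF assms])
  ultimately show ?thesis by blast
qed

section \<open>Squarefree monomial ideals\<close>

text \<open>
  For an upward closed family \<open>U\<close> this is an ideal spanned by monomials, and membership of a monomial
  depends only on its support: these are the squarefree monomial ideals. The edge ideal and the
  ideals generated by variables are the two instances that matter here.
\<close>

definition squarefree_ideal :: "'v set \<Rightarrow> 'v set set \<Rightarrow> (('v \<Rightarrow>\<^sub>0 nat) \<Rightarrow>\<^sub>0 'k::field) set" where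
  "squarefree_ideal V U = {p \<in> carrier (mpoly_ring V). \<forall>m\<in>Poly_Mapping.keys p. Poly_Mapping.keys m \<in> U}"

lemma ring_mpoly_ring: "ring (mpoly_ring V :: (('v \<Rightarrow>\<^sub>0 nat) \<Rightarrow>\<^sub>0 'k::field) ring)"
  by (rule cring.axioms(1)[OF cring_mpoly_ring])

lemma mpoly_mult_closed:
  fixes p q :: "('v \<Rightarrow>\<^sub>0 nat) \<Rightarrow>\<^sub>0 'k::field"
  assumes "p \<in> carrier (mpoly_ring V)" "q \<in> carrier (mpoly_ring V)"
  shows "p * q \<in> carrier (mpoly_ring V)"
  using mpoly_ring_mult_closed[OF assms[unfolded mpoly_ring_simps(1)]]
  unfolding mpoly_ring_simps(1) .

lemma mpoly_var_closed:
  "v \<in> V \<Longrightarrow> mpoly_var v \<in> carrier (mpoly_ring V :: (('v \<Rightarrow>\<^sub>0 nat) \<Rightarrow>\<^sub>0 'k::field) ring)"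
  by (simp add: mpoly_var_def)

lemma ideal_squarefree_ideal:
  assumes up: "\<And>S T. S \<in> U \<Longrightarrow> S \<subseteq> T \<Longrightarrow> T \<in> U"
  shows "ideal (squarefree_ideal V U) (mpoly_ring V :: (('v \<Rightarrow>\<^sub>0 nat) \<Rightarrow>\<^sub>0 'k::field) ring)"
proof -
  let ?R = "mpoly_ring V :: (('v \<Rightarrow>\<^sub>0 nat) \<Rightarrow>\<^sub>0 'k) ring"
  interpret ring ?R by (rule ring_mpoly_ring)
  have mult: "p * q \<in> squarefree_ideal V U"
    if "p \<in> squarefree_ideal V U" "q \<in> carrier ?R" for p q :: "('v \<Rightarrow>\<^sub>0 nat) \<Rightarrow>\<^sub>0 'k"
  proof -
    have "Poly_Mapping.keys m \<in> U" if m: "m \<in> Poly_Mapping.keys (p * q)" for m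
    proof -
      obtain k l where "m = k + l" "k \<in> Poly_Mapping.keys p"
        using m keys_mult[of p q] by blast
      with \<open>p \<in> squarefree_ideal V U\<close> show ?thesis
        by (auto simp: squarefree_ideal_def keys_add_nat intro: up)
    qed
    with that m_closed[of p q] show ?thesis
      by (auto simp: squarefree_ideal_def)
  qed
  show ?thesis
  proof (rule idealI)
    show "subgroup (squarefree_ideal V U) (add_monoid ?R)"
    proof (rule add.subgroupI)
      show "squarefree_ideal V U \<subseteq> carrier ?R" by (auto simp: squarefree_ideal_def)
      have "0 \<in> (squarefree_ideal V U :: (('v \<Rightarrow>\<^sub>0 nat) \<Rightarrow>\<^sub>0 'k) set)"
        by (simp add: squarefree_ideal_def)
      then show "(squarefree_ideal V U :: (('v \<Rightarrow>\<^sub>0 nat) \<Rightarrow>\<^sub>0 'k) set) \<noteq> {}" by blast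
    next
      fix p :: "('v \<Rightarrow>\<^sub>0 nat) \<Rightarrow>\<^sub>0 'k" assume p: "p \<in> squarefree_ideal V U"
      then have "\<ominus>\<^bsub>?R\<^esub> p = - p"
        by (intro minus_equality) (auto simp: squarefree_ideal_def)
      with p show "\<ominus>\<^bsub>?R\<^esub> p \<in> squarefree_ideal V U" by (simp add: squarefree_ideal_def)
    next
      fix p q :: "('v \<Rightarrow>\<^sub>0 nat) \<Rightarrow>\<^sub>0 'k"
      assume "p \<in> squarefree_ideal V U" "q \<in> squarefree_ideal V U"
      then show "p \<oplus>\<^bsub>?R\<^esub> q \<in> squarefree_ideal V U"
        using Poly_Mapping.keys_add[of p q] by (fastforce simp: squarefree_ideal_def)
    qed
  qed (use mult in \<open>auto simp: ring_mpoly_ring mult.commute\<close>)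
qed

text \<open>The ideal generated by the variables in \<open>V\<close> outside \<open>S\<close>.\<close>

definition variables_prime :: "'v set \<Rightarrow> 'v set \<Rightarrow> (('v \<Rightarrow>\<^sub>0 nat) \<Rightarrow>\<^sub>0 'k::field) set" where
  "variables_prime V S = squarefree_ideal V {T. \<not> T \<subseteq> S}"

lemma primeideal_variables_prime:
  assumes "finite S"
  shows "primeideal (variables_prime V S) (mpoly_ring V :: (('v \<Rightarrow>\<^sub>0 nat) \<Rightarrow>\<^sub>0 'k::field) ring)"
proof (rule primeidealI)
  show "ideal (variables_prime V S) (mpoly_ring V :: (('v \<Rightarrow>\<^sub>0 nat) \<Rightarrow>\<^sub>0 'k) ring)"
    unfolding variables_prime_def by (rule ideal_squarefree_ideal) auto
  have "1 \<in> carrier (mpoly_ring V :: (('v \<Rightarrow>\<^sub>0 nat) \<Rightarrow>\<^sub>0 'k) ring)"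
    "1 \<notin> (variables_prime V S :: (('v \<Rightarrow>\<^sub>0 nat) \<Rightarrow>\<^sub>0 'k) set)"
    by (auto simp: variables_prime_def squarefree_ideal_def)
  then show "carrier (mpoly_ring V :: (('v \<Rightarrow>\<^sub>0 nat) \<Rightarrow>\<^sub>0 'k) ring) \<noteq> variables_prime V S"
    by metis
next
  fix p q :: "('v \<Rightarrow>\<^sub>0 nat) \<Rightarrow>\<^sub>0 'k"
  assume "p \<in> carrier (mpoly_ring V)" "q \<in> carrier (mpoly_ring V)" "p \<otimes>\<^bsub>mpoly_ring V\<^esub> q \<in> variables_prime V S"
  with keys_mult_supported[OF assms, of p q]
  show "p \<in> variables_prime V S \<or> q \<in> variables_prime V S"
    by (auto simp: variables_prime_def squarefree_ideal_def)
qed (rule cring_mpoly_ring)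

text \<open>
  The right-hand side is an ideal that contains the generators. Conversely, each term of one of its elements
  is a multiple of the monomial of an edge contained in its support.
\<close>

lemma edge_ideal_eq_squarefree_ideal:
  assumes G: "simple_graph V E"
  shows "edge_ideal V E = (squarefree_ideal V {T. \<exists>e\<in>E. e \<subseteq> T} :: (('v \<Rightarrow>\<^sub>0 nat) \<Rightarrow>\<^sub>0 'k::field) set)"
proof
  let ?R = "mpoly_ring V :: (('v \<Rightarrow>\<^sub>0 nat) \<Rightarrow>\<^sub>0 'k) ring"
  let ?J = "squarefree_ideal V {T. \<exists>e\<in>E. e \<subseteq> T} :: (('v \<Rightarrow>\<^sub>0 nat) \<Rightarrow>\<^sub>0 'k) set"
  have edge_finite: "finite e" "e \<subseteq> V" if "e \<in> E" for e
    using that G by (auto simp: simple_graph_def intro: finite_subset)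
  show "edge_ideal V E \<subseteq> ?J"
    unfolding edge_ideal_def
  proof (rule ring.genideal_minimal[OF ring_mpoly_ring])
    show "ideal ?J ?R" by (rule ideal_squarefree_ideal) auto
    show "edge_monomial ` E \<subseteq> ?J"
    proof (rule image_subsetI)
      fix e assume "e \<in> E"
      with edge_finite[OF this] show "edge_monomial e \<in> ?J"
        by (auto simp: squarefree_ideal_def edge_monomial_eq_single)
    qed
  qed
  interpret ideal "edge_ideal V E" ?R by (rule ideal_edge_ideal[OF G])
  show "?J \<subseteq> edge_ideal V E"
  proof
    fix p :: "('v \<Rightarrow>\<^sub>0 nat) \<Rightarrow>\<^sub>0 'k" assume p: "p \<in> ?J"
    have "Poly_Mapping.single m c \<in> edge_ideal V E" if m: "m \<in> Poly_Mapping.keys p" for m and c :: 'k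
    proof -
      obtain e where e: "e \<in> E" "e \<subseteq> Poly_Mapping.keys m"
        using p m by (auto simp: squarefree_ideal_def)
      have fin: "finite e" using edge_finite e(1) by blast
      define k where "k = m - squarefree_monomial e"
      have "m = k + squarefree_monomial e"
        unfolding k_def using e(2)
        by (intro poly_mapping_eqI)
          (auto simp: lookup_add lookup_minus lookup_squarefree_monomial[OF fin] when_def in_keys_iff)
      then have "Poly_Mapping.single m c = Poly_Mapping.single k c * edge_monomial e"
        by (simp add: edge_monomial_eq_single[OF fin] mult_single)
      moreover have "edge_monomial e \<in> (edge_ideal V E :: (('v \<Rightarrow>\<^sub>0 nat) \<Rightarrow>\<^sub>0 'k) set)"
        unfolding edge_ideal_def using genideal_self[of "edge_monomial ` E"] edge_monomial_closed[OF G] e(1)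
        by blast
      moreover have "Poly_Mapping.single k c \<in> carrier ?R"
      proof -
        have "Poly_Mapping.keys m \<subseteq> V" using p m by (auto simp: squarefree_ideal_def)
        moreover have "Poly_Mapping.keys k \<subseteq> Poly_Mapping.keys m"
          by (auto simp: k_def in_keys_iff lookup_minus)
        ultimately show ?thesis by auto
      qed
      ultimately show ?thesis using I_l_closed by fastforce
    qed
    moreover have "(\<Sum>m\<in>M. Poly_Mapping.single m (Poly_Mapping.lookup p m)) \<in> edge_ideal V E"
      if "finite M" "\<And>m. m \<in> M \<Longrightarrow> Poly_Mapping.single m (Poly_Mapping.lookup p m) \<in> edge_ideal V E" for M
      using that
    proof (induction M rule: finite_induct)
      case empty
      then show ?case
        using additive_subgroup.zero_closed[OF additive_subgroup_axioms] by (simp only: sum.empty mpoly_ring_simps(5))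
    next
      case (insert m M)
      then show ?case
        using additive_subgroup.a_closed[OF additive_subgroup_axioms]
        by (simp add: insert.hyps del: mpoly_ring_simps(1))
    qed
    moreover have "p = (\<Sum>m\<in>Poly_Mapping.keys p. Poly_Mapping.single m (Poly_Mapping.lookup p m))"
      by (rule poly_mapping_eqI) (simp add: lookup_sum lookup_single when_def in_keys_iff)
    ultimately show "p \<in> edge_ideal V E" by (metis finite_keys)
  qed
qed

section \<open>Associated primes\<close>

lemma associated_primes_eq_colon:
  assumes "ideal I R"
  shows "associated_primes R I =
    {Q. primeideal Q R \<and> (\<exists>f\<in>carrier R. Q = {r \<in> carrier R. r \<otimes>\<^bsub>R\<^esub> f \<in> I})}"
proof -
  interpret ideal I R by fact
  have "I +>\<^bsub>R\<^esub> g = I \<longleftrightarrow> g \<in> I" if "g \<in> carrier R" for g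
    using that a_rcos_zero[OF assms, of g] a_rcos_self[OF that] by auto
  then have "(I +>\<^bsub>R\<^esub> r) \<otimes>\<^bsub>R Quot I\<^esub> (I +>\<^bsub>R\<^esub> f) = \<zero>\<^bsub>R Quot I\<^esub> \<longleftrightarrow> r \<otimes>\<^bsub>R\<^esub> f \<in> I"
    if "r \<in> carrier R" "f \<in> carrier R" for r f
    using that by (simp add: FactRing_def rcoset_mult_add)
  then have "{r \<in> carrier R. (I +>\<^bsub>R\<^esub> r) \<otimes>\<^bsub>R Quot I\<^esub> (I +>\<^bsub>R\<^esub> f) = \<zero>\<^bsub>R Quot I\<^esub>}
      = {r \<in> carrier R. r \<otimes>\<^bsub>R\<^esub> f \<in> I}" if "f \<in> carrier R" for f
    using that by blast
  moreover have "carrier (R Quot I) = (\<lambda>f. I +>\<^bsub>R\<^esub> f) ` carrier R"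
    by (auto simp: FactRing_simps)
  ultimately show ?thesis by (auto simp: associated_primes_def)
qed

text \<open>
  Take \<open>S\<close> to be a maximal independent set containing \<open>I\<close>. A monomial times the product of the variables
  in \<open>S\<close> lies in the edge ideal if and only if it involves a vertex outside \<open>S\<close>: if it does,
  enlarging \<open>S\<close> by that vertex creates an edge.
\<close>

lemma associated_prime_of_independent_set:
  assumes G: "simple_graph V E" and I: "I \<subseteq> V" "\<forall>e\<in>E. \<not> e \<subseteq> I"
  obtains S where "I \<subseteq> S" "S \<subseteq> V" "\<forall>e\<in>E. \<not> e \<subseteq> S"
    "(variables_prime V S :: (('v \<Rightarrow>\<^sub>0 nat) \<Rightarrow>\<^sub>0 'k::field) set)
       \<in> associated_primes (mpoly_ring V) (edge_ideal V E)"
proof -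
  let ?R = "mpoly_ring V :: (('v \<Rightarrow>\<^sub>0 nat) \<Rightarrow>\<^sub>0 'k) ring"
  define A where "A = {S. S \<subseteq> V \<and> (\<forall>e\<in>E. \<not> e \<subseteq> S)}"
  have "finite A" "I \<in> A"
    using G I by (simp_all add: simple_graph_def A_def)
  from finite_has_maximal2[OF this] obtain S where S: "I \<subseteq> S" "S \<in> A"
    and maximal: "\<forall>T\<in>A. S \<subseteq> T \<longrightarrow> S = T"
    by blast
  have S: "I \<subseteq> S" "S \<subseteq> V" "\<forall>e\<in>E. \<not> e \<subseteq> S"
    using S by (simp_all add: A_def)
  have fin: "finite S" using G S(2) by (auto simp: simple_graph_def intro: finite_subset)
  define f :: "('v \<Rightarrow>\<^sub>0 nat) \<Rightarrow>\<^sub>0 'k" where "f = edge_monomial S"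
  have f: "f \<in> carrier ?R"
    using S(2) fin by (simp add: f_def edge_monomial_eq_single)
  have "r * f \<in> edge_ideal V E \<longleftrightarrow> r \<in> variables_prime V S" if r: "r \<in> carrier ?R" for r
  proof -
    have rf: "r * f \<in> carrier ?R"
      by (rule mpoly_mult_closed[OF r f])
    have keys: "Poly_Mapping.keys (r * f) = (+) (squarefree_monomial S) ` Poly_Mapping.keys r"
      using keys_edge_monomial_mult[OF fin, of r] by (simp add: f_def mult.commute)
    have edge: "(\<exists>e\<in>E. e \<subseteq> S \<union> T) \<longleftrightarrow> \<not> T \<subseteq> S" if "T \<subseteq> V" for T
    proof
      assume "\<exists>e\<in>E. e \<subseteq> S \<union> T"
      with S(3) show "\<not> T \<subseteq> S" by (metis Un_absorb2)
    next
      assume "\<not> T \<subseteq> S"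
      then have "S \<union> T \<notin> A" using maximal by blast
      with that S(2) show "\<exists>e\<in>E. e \<subseteq> S \<union> T" by (simp add: A_def)
    qed
    have "r * f \<in> edge_ideal V E \<longleftrightarrow> (\<forall>m\<in>Poly_Mapping.keys r. \<exists>e\<in>E. e \<subseteq> S \<union> Poly_Mapping.keys m)"
      using rf by (simp add: edge_ideal_eq_squarefree_ideal[OF G] squarefree_ideal_def keys keys_add_nat fin
          del: mpoly_ring_simps)
    also have "\<dots> \<longleftrightarrow> r \<in> variables_prime V S"
      using r edge by (auto simp: variables_prime_def squarefree_ideal_def)
    finally show ?thesis .
  qed
  then have "variables_prime V S = {r \<in> carrier ?R. r \<otimes>\<^bsub>?R\<^esub> f \<in> edge_ideal V E}"
    by (auto simp: variables_prime_def squarefree_ideal_def)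
  with f primeideal_variables_prime[OF fin, of V]
  have "(variables_prime V S :: (('v \<Rightarrow>\<^sub>0 nat) \<Rightarrow>\<^sub>0 'k) set) \<in> associated_primes ?R (edge_ideal V E)"
    unfolding associated_primes_eq_colon[OF ideal_edge_ideal[OF G]] by blast
  with S that show thesis by blast
qed

section \<open>Regular edges\<close>

lemma edgeE:
  assumes "simple_graph V E" "e \<in> E"
  obtains x y where "e = {x, y}" "x \<noteq> y" "x \<in> V" "y \<in> V"
proof -
  have "e \<subseteq> V" "card e = 2" using assms unfolding simple_graph_def by blast+
  with that show thesis by (auto simp: card_2_iff)
qed

lemma doubleton_edgeD:
  assumes "simple_graph V E" "{x, y} \<in> E"
  shows "x \<noteq> y" "x \<in> V" "y \<in> V"
  using edgeE[OF assms] by (metis doubleton_eq_iff)+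

lemma mpoly_var_eq_edge_monomial: "mpoly_var v = edge_monomial {v}"
  by (simp add: edge_monomial_def)

lemma keys_mpoly_var_mult:
  fixes f :: "('v \<Rightarrow>\<^sub>0 nat) \<Rightarrow>\<^sub>0 'k::field"
  shows "Poly_Mapping.keys ` Poly_Mapping.keys (mpoly_var v * f)
    = insert v ` Poly_Mapping.keys ` Poly_Mapping.keys f"
  by (simp add: mpoly_var_eq_edge_monomial keys_edge_monomial_mult image_image keys_add_nat)

lemma mpoly_var_in_variables_prime:
  "(mpoly_var v :: ('v \<Rightarrow>\<^sub>0 nat) \<Rightarrow>\<^sub>0 'k::field) \<in> variables_prime V S \<longleftrightarrow> v \<in> V - S"
  by (auto simp: mpoly_var_def variables_prime_def squarefree_ideal_def)

lemma mem_edge_ideal_iff: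
  fixes f :: "('v \<Rightarrow>\<^sub>0 nat) \<Rightarrow>\<^sub>0 'k::field"
  assumes "simple_graph V E" "f \<in> carrier (mpoly_ring V)"
  shows "f \<in> edge_ideal V E \<longleftrightarrow> (\<forall>T\<in>Poly_Mapping.keys ` Poly_Mapping.keys f. \<exists>e\<in>E. e \<subseteq> T)"
  using assms(2) by (simp add: edge_ideal_eq_squarefree_ideal[OF assms(1)] squarefree_ideal_def)

lemma var_mult_mem_edge_ideal_iff:
  fixes f :: "('v \<Rightarrow>\<^sub>0 nat) \<Rightarrow>\<^sub>0 'k::field"
  assumes "simple_graph V E" "f \<in> carrier (mpoly_ring V)" "v \<in> V"
  shows "mpoly_var v * f \<in> edge_ideal V E
    \<longleftrightarrow> (\<forall>T\<in>Poly_Mapping.keys ` Poly_Mapping.keys f. \<exists>e\<in>E. e \<subseteq> insert v T)"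
proof -
  have "mpoly_var v * f \<in> carrier (mpoly_ring V)"
    by (rule mpoly_mult_closed[OF mpoly_var_closed[OF assms(3)] assms(2)])
  from mem_edge_ideal_iff[OF assms(1) this] show ?thesis
    unfolding keys_mpoly_var_mult by simp
qed

text \<open>
  A variable \<open>y\<close> outside \<open>Q = (I : f)\<close> leads to an independent set \<open>S\<close> containing \<open>y\<close> such that \<open>Q\<close> lies in the
  prime ideal of the variables outside \<open>S\<close>. A product of two elements of \<open>Q\<close> could have the monomial \<open>xy\<close>
  only if one of them had the monomial \<open>1\<close> or \<open>y\<close>, and both are supported in \<open>S\<close>.
\<close>

lemma edge_monomial_not_in_square:
  fixes Q :: "(('v \<Rightarrow>\<^sub>0 nat) \<Rightarrow>\<^sub>0 'k::field) set"
  assumes G: "simple_graph V E" and xy: "x \<in> V" "y \<in> V" "x \<noteq> y"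
    and Q: "Q = {r \<in> carrier (mpoly_ring V). r * f \<in> edge_ideal V E}"
    and f: "f \<in> carrier (mpoly_ring V)" and y: "mpoly_var y \<notin> Q"
  shows "edge_monomial {x, y} \<notin> ideal_prod (mpoly_ring V) Q Q"
proof
  let ?R = "mpoly_ring V :: (('v \<Rightarrow>\<^sub>0 nat) \<Rightarrow>\<^sub>0 'k) ring"
  have "mpoly_var y * f \<notin> edge_ideal V E"
    using y mpoly_var_closed[OF xy(2)] by (auto simp: Q simp del: mpoly_ring_simps)
  then obtain m where m: "m \<in> Poly_Mapping.keys f" "\<forall>e\<in>E. \<not> e \<subseteq> insert y (Poly_Mapping.keys m)"
    by (auto simp: var_mult_mem_edge_ideal_iff[OF G f xy(2)])
  \<comment> \<open>the prime ideal of the variables outside \<open>S\<close> contains the edge ideal but not \<open>f\<close>, hence it contains \<open>Q\<close>\<close>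
  define S where "S = insert y (Poly_Mapping.keys m)"
  have no_S: "\<not> Poly_Mapping.keys k \<subseteq> S" if "r \<in> Q" "k \<in> Poly_Mapping.keys r" for r k
  proof
    assume "Poly_Mapping.keys k \<subseteq> S"
    with that m(1) have "\<exists>l\<in>Poly_Mapping.keys (r * f). Poly_Mapping.keys l \<subseteq> S"
      by (intro keys_mult_supported) (auto simp: S_def)
    moreover have "\<forall>l\<in>Poly_Mapping.keys (r * f). \<exists>e\<in>E. e \<subseteq> Poly_Mapping.keys l"
      using that(1) by (simp add: Q edge_ideal_eq_squarefree_ideal[OF G] squarefree_ideal_def)
    ultimately show False using m(2) unfolding S_def by (meson order_trans)
  qed
  have "squarefree_monomial {x, y} \<notin> Poly_Mapping.keys p" if "p \<in> ideal_prod ?R Q Q" for p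
    using that
  proof (induction rule: ideal_prod.induct)
    case (prod i j)
    show ?case
    proof
      assume "squarefree_monomial {x, y} \<in> Poly_Mapping.keys (i \<otimes>\<^bsub>?R\<^esub> j)"
      then obtain k l where kl: "k \<in> Poly_Mapping.keys i" "l \<in> Poly_Mapping.keys j" "squarefree_monomial {x, y} = k + l"
        using keys_mult[of i j] by auto
      \<comment> \<open>\<open>x\<close> has exponent one, so it divides only one of the two factors\<close>
      have "Poly_Mapping.lookup k x + Poly_Mapping.lookup l x = 1"
        using arg_cong[OF kl(3), of "\<lambda>m. Poly_Mapping.lookup m x"]
        by (simp add: lookup_squarefree_monomial lookup_add)
      then have "x \<notin> Poly_Mapping.keys k \<or> x \<notin> Poly_Mapping.keys l"
        by (auto simp: in_keys_iff)
      moreover have "Poly_Mapping.keys k \<union> Poly_Mapping.keys l = {x, y}"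
        using arg_cong[OF kl(3), of Poly_Mapping.keys] by (simp add: keys_add_nat)
      then have "Poly_Mapping.keys k \<subseteq> {x, y}" "Poly_Mapping.keys l \<subseteq> {x, y}"
        by (metis Un_upper1, metis Un_upper2)
      ultimately have "Poly_Mapping.keys k \<subseteq> {y} \<or> Poly_Mapping.keys l \<subseteq> {y}"
        by blast
      then have "Poly_Mapping.keys k \<subseteq> S \<or> Poly_Mapping.keys l \<subseteq> S"
        by (auto simp: S_def)
      with no_S prod kl show False by blast
    qed
  next
    case (sum p q)
    then show ?case using Poly_Mapping.keys_add[of p q] by auto
  qed
  moreover have "squarefree_monomial {x, y} \<in> Poly_Mapping.keys (edge_monomial {x, y} :: ('v \<Rightarrow>\<^sub>0 nat) \<Rightarrow>\<^sub>0 'k)"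
    by (simp add: edge_monomial_eq_single)
  moreover assume "edge_monomial {x, y} \<in> ideal_prod ?R Q Q"
  ultimately show False by blast
qed

text \<open>
  A monomial of \<open>f\<close> outside the edge ideal \<open>I\<close> has independent support \<open>T\<close>. If \<open>x\<close> and \<open>y\<close> both multiply it into \<open>I\<close>,
  then \<open>T\<close> contains a neighbour \<open>a\<close> of \<open>x\<close> and a neighbour \<open>b\<close> of \<open>y\<close>, and Property \<open>P\<close> supplies the
  edge \<open>{a, b}\<close> inside \<open>T\<close>.
\<close>

lemma property_P_imp_not_both_vars:
  fixes Q :: "(('v \<Rightarrow>\<^sub>0 nat) \<Rightarrow>\<^sub>0 'k::field) set"
  assumes G: "simple_graph V E" and e: "{x, y} \<in> E" and P: "property_P V E {x, y}"
    and Q: "Q = {r \<in> carrier (mpoly_ring V). r * f \<in> edge_ideal V E}" "1 \<notin> Q"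
    and f: "f \<in> carrier (mpoly_ring V)"
  shows "mpoly_var x \<notin> Q \<or> mpoly_var y \<notin> Q"
proof (rule ccontr)
  note xy = doubleton_edgeD[OF G e]
  have edge: "\<exists>u\<in>T. {u, v} \<in> E" if g: "g \<in> E" "g \<subseteq> insert v T" "\<not> g \<subseteq> T" for g v T
  proof -
    obtain a b where ab: "g = {a, b}" "a \<noteq> b"
      by (rule edgeE[OF G g(1)])
    with g(2,3) consider "v = a" "b \<in> T" | "v = b" "a \<in> T" by auto
    then show ?thesis using g(1) ab(1) by cases (auto simp: insert_commute)
  qed
  assume "\<not> ?thesis"
  then have "mpoly_var x * f \<in> edge_ideal V E" "mpoly_var y * f \<in> edge_ideal V E"
    unfolding Q by blast+
  then have near: "\<forall>T\<in>Poly_Mapping.keys ` Poly_Mapping.keys f. (\<exists>g\<in>E. g \<subseteq> insert x T) \<and> (\<exists>g\<in>E. g \<subseteq> insert y T)"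
    using var_mult_mem_edge_ideal_iff[OF G f xy(2)] var_mult_mem_edge_ideal_iff[OF G f xy(3)] by blast
  have "f \<notin> edge_ideal V E" using Q(2) unfolding Q(1) by simp
  then obtain T where T: "T \<in> Poly_Mapping.keys ` Poly_Mapping.keys f" "\<forall>g\<in>E. \<not> g \<subseteq> T"
    using mem_edge_ideal_iff[OF G f] by blast
  obtain a b where ab: "a \<in> T" "{a, x} \<in> E" "b \<in> T" "{b, y} \<in> E"
    using near T edge by meson
  have "{y, b} \<in> E" using ab(4) by (simp add: insert_commute)
  with P[unfolded property_P_def, rule_format, OF refl, of a b] ab(2)
  have "{a, b} \<in> E"
    using doubleton_edgeD(2)[OF G ab(2)] doubleton_edgeD(2)[OF G ab(4)] by simp
  with T(2) have "\<not> {a, b} \<subseteq> T" by (rule bspec)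
  with ab(1,3) show False by simp
qed

theorem theorem3p6:
  fixes V :: "'v set" and E :: "'v set set" and e :: "'v set"
  assumes "simple_graph V E" and "e \<in> E"
  shows "regular_edge TYPE('k::field) V E e \<longleftrightarrow> property_P V E e"
proof
  let ?R = "mpoly_ring V :: (('v \<Rightarrow>\<^sub>0 nat) \<Rightarrow>\<^sub>0 'k) ring"
  note ass_primes = associated_primes_eq_colon[OF ideal_edge_ideal[OF assms(1)]]
  show "property_P V E e" if regular: "regular_edge TYPE('k) V E e"
    unfolding property_P_def
  proof (intro allI impI ballI, elim conjE, rule ccontr)
    fix x y a b
    assume e: "e = {x, y}" and ab: "a \<in> V" "b \<in> V" "{a, x} \<in> E" "{y, b} \<in> E"
      and not_P: "\<not> (a \<noteq> b \<and> {a, b} \<in> E)"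
    \<comment> \<open>if \<open>a = b\<close>, this set is a singleton and too small to contain an edge\<close>
    have indep: "\<forall>g\<in>E. \<not> g \<subseteq> {a, b}"
    proof (intro ballI notI)
      fix g assume g: "g \<in> E" "g \<subseteq> {a, b}"
      obtain u v where "g = {u, v}" "u \<noteq> v" by (rule edgeE[OF assms(1) g(1)])
      with g have "a \<noteq> b" "g = {a, b}" by auto
      with g(1) not_P show False by blast
    qed
    obtain S where S: "{a, b} \<subseteq> S" "\<forall>g\<in>E. \<not> g \<subseteq> S"
      and prime: "(variables_prime V S :: (('v \<Rightarrow>\<^sub>0 nat) \<Rightarrow>\<^sub>0 'k) set) \<in> associated_primes ?R (edge_ideal V E)"
      by (rule associated_prime_of_independent_set[OF assms(1) _ indep, where 'k='k]) (use ab in auto)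
    have "x \<notin> S" "y \<notin> S"
      using S(1) S(2)[rule_format, OF ab(3)] S(2)[rule_format, OF ab(4)] by simp_all
    moreover have "x \<noteq> y" "x \<in> V" "y \<in> V"
      using doubleton_edgeD[OF assms(1) assms(2)[unfolded e]] .
    ultimately have "edge_monomial e \<in> ideal_prod ?R (variables_prime V S) (variables_prime V S)"
      using ideal_prod.prod[of "mpoly_var x" "variables_prime V S" "mpoly_var y" "variables_prime V S" ?R]
      by (simp add: e edge_monomial_doubleton mpoly_var_in_variables_prime)
    with regular prime show False by (auto simp: regular_edge_def)
  qed
  show "regular_edge TYPE('k) V E e" if P: "property_P V E e"
    unfolding regular_edge_def
  proof
    fix Q :: "(('v \<Rightarrow>\<^sub>0 nat) \<Rightarrow>\<^sub>0 'k) set"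
    assume "Q \<in> associated_primes ?R (edge_ideal V E)"
    then obtain f where prime: "primeideal Q ?R" and f: "f \<in> carrier ?R"
      and Q: "Q = {r \<in> carrier ?R. r * f \<in> edge_ideal V E}"
      by (auto simp: ass_primes simp del: mpoly_ring_simps(1))
    have "1 \<notin> Q"
      using primeideal.I_notcarr[OF prime] ideal.one_imp_carrier[OF primeideal.axioms(1)[OF prime]] by auto
    obtain x y where xy: "e = {x, y}" "x \<noteq> y" "x \<in> V" "y \<in> V"
      by (rule edgeE[OF assms])
    have "mpoly_var x \<notin> Q \<or> mpoly_var y \<notin> Q"
      by (rule property_P_imp_not_both_vars[OF assms(1) assms(2)[unfolded xy] P[unfolded xy] Q \<open>1 \<notin> Q\<close> f])
    then show "edge_monomial e \<notin> ideal_prod ?R Q Q"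
    proof
      assume "mpoly_var y \<notin> Q"
      from edge_monomial_not_in_square[OF assms(1) xy(3,4,2) Q f this] show ?thesis
        unfolding xy(1) .
    next
      assume "mpoly_var x \<notin> Q"
      from edge_monomial_not_in_square[OF assms(1) xy(4,3) xy(2)[symmetric] Q f this] show ?thesis
        unfolding xy(1) insert_commute[of x y] .
    qed
  qed
qed

end
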